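(* Let $0<k<1$ and let $g,g_a\in L^1_+(\mathbb{R})$ satisfy $\|g\|_1\le k$ and $\|g_a\|_1\le k$. Let $h,h_a$ be the integrable functions vanishing on $(-\infty,0)$ that solve $$h(t)=g(t)+\int_0^t h(\tau)g(t-\tau)\,d\tau,\qquad h_a(t)=g_a(t)+\int_0^t h_a(\tau)g_a(t-\tau)\,d\tau\qquad(t\ge0).$$ Then $$\|h-h_a\|_1\le \frac{1}{(1-k)^2}\|g-g_a\|_1\qquad\text{and}\qquad \|h-h_a\|_\infty\le\frac{1}{(1-k)^2}\|g-g_a\|_\infty .$$
   Context: $L^1_+(\mathbb{R})$ denotes the set of integrable functions $\varphi$ on $\mathbb{R}$ with $\varphi(t)\ge0$ for $t\ge0$ and $\varphi(t)=0$ for $t<0$. Here $\|u\|_1=\int_0^\infty|u(t)|\,dt$ and $\|u\|_\infty=\sup_{t\ge0}|u(t)|$ (possibly $+\infty$); since elements of $L^1$ are identified when equal almost everywhere, the integral equations are understood almost everywhere and the supremum as an essential supremum. *)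

theory Defs
  imports "HOL-Analysis.Analysis" "HOL-Probability.Essential_Supremum"
begin

text \<open>
  Elements of \<open>L\<^sup>1\<close> are represented by Lebesgue integrable functions on the real line, not
  by equivalence classes; all pointwise conditions are therefore imposed almost everywhere.
\<close>

definition L1_plus :: "(real \<Rightarrow> real) set" where
  "L1_plus = {\<phi>. integrable lebesgue \<phi> \<and>
     (AE t in lebesgue. (0 \<le> t \<longrightarrow> 0 \<le> \<phi> t) \<and> (t < 0 \<longrightarrow> \<phi> t = 0))}"

text \<open>
  The Bochner integral of a non-integrable function is \<open>0\<close>, so \<open>L1_norm\<close> is meaningful
  only for functions integrable on the half-line.
\<close>

definition L1_norm :: "(real \<Rightarrow> real) \<Rightarrow> real" where
  "L1_norm u = (LINT t:{0..}|lebesgue. \<bar>u t\<bar>)"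

definition Linf_norm :: "(real \<Rightarrow> real) \<Rightarrow> ereal" where
  "Linf_norm u = esssup (restrict_space lebesgue {0..}) (\<lambda>t. ereal \<bar>u t\<bar>)"

text \<open>
  For integrable \<open>g\<close> and \<open>h\<close> the convolution integrand is integrable for almost every \<open>t\<close>
  (Fubini), so the default value \<open>0\<close> of the integral elsewhere does not affect the equation.
\<close>

definition solves_renewal :: "(real \<Rightarrow> real) \<Rightarrow> (real \<Rightarrow> real) \<Rightarrow> bool" where
  "solves_renewal g h \<longleftrightarrow>
     integrable lebesgue h \<and>
     (AE t in lebesgue. t < 0 \<longrightarrow> h t = 0) \<and>
     (AE t in lebesgue. 0 \<le> t \<longrightarrow> h t = g t + (LINT \<tau>:{0..t}|lebesgue. h \<tau> * g (t - \<tau>)))"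

end

theory Submission
  imports Defs
begin

text \<open>
  Write \<open>d = g - g\<^sub>a\<close> and \<open>e = h - h\<^sub>a\<close>. Subtracting the two renewal equations
  \<open>h = g + h * g\<close> and \<open>h\<^sub>a = g\<^sub>a + h\<^sub>a * g\<^sub>a\<close> and adding and subtracting \<open>h\<^sub>a * g\<close> gives
  \<open>e = (d + h\<^sub>a * d) + e * g\<close> (\<open>renewal_difference\<close>). Convolution with \<open>g\<close> has norm at most
  \<open>k < 1\<close> on both \<open>L\<^sup>1\<close> and \<open>L\<^sup>\<infinity>\<close>, so the term \<open>e * g\<close> can be absorbed at the cost of a factor
  \<open>1 / (1 - k)\<close>. The same absorption in the equation for \<open>h\<^sub>a\<close> shows that the \<open>L\<^sup>1\<close> norm of
  \<open>h\<^sub>a\<close> is at most \<open>k / (1 - k)\<close> (\<open>renewal_L1_bound\<close>). Hence the norm of \<open>d + h\<^sub>a * d\<close> is at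
  most \<open>1 + k / (1 - k) = 1 / (1 - k)\<close> times that of \<open>d\<close>, which is the second factor.

  Absorbing requires the absorbed norm to be finite. This is clear in \<open>L\<^sup>1\<close>
  (\<open>L1_contraction\<close>), but \<open>e\<close> is not known in advance to be bounded. In \<open>sup_contraction\<close> the
  supremum bound is therefore deduced from the \<open>L\<^sup>1\<close> bound: the excess of \<open>\<bar>e\<bar>\<close> over
  the expected bound is an integrable function dominated by its own convolution with \<open>\<bar>g\<bar>\<close>,
  and thus vanishes.

  Fubini's theorem is a statement about the product of Borel measures, so these arguments are
  carried out on the whole line for Borel functions. Each of the four given functions agrees
  almost everywhere with a Borel function that vanishes at every negative point; for these the
  integral over \<open>{0..t}\<close> is the full convolution integral, for every \<open>t\<close>
  (\<open>set_lebesgue_integral_conv\<close>).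
\<close>

section \<open>Convolution of integrable functions on the line\<close>

definition conv :: "(real \<Rightarrow> real) \<Rightarrow> (real \<Rightarrow> real) \<Rightarrow> real \<Rightarrow> real" where
  "conv f g t = (LINT \<tau>|lborel. f \<tau> * g (t - \<tau>))"

lemma integrable_reflect:
  fixes g :: "real \<Rightarrow> real"
  assumes "integrable lborel g"
  shows "integrable lborel (\<lambda>\<tau>. g (t - \<tau>))"
  using lborel_integrable_real_affine[OF assms, of "-1" t] by simp

lemma integral_reflect:
  fixes g :: "real \<Rightarrow> real"
  shows "(LINT \<tau>|lborel. g (t - \<tau>)) = (LINT \<tau>|lborel. g \<tau>)"
  using lborel_integral_real_affine[of "-1" g t] by simp

text \<open>
  The joint integrability that licenses Fubini's theorem: since Lebesgue measure is translation
  invariant, integrating the absolute value first over \<open>t\<close> gives \<open>\<bar>f \<tau>\<bar>\<close> times the norm of \<open>g\<close>.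
\<close>
lemma integrable_conv_kernel:
  fixes f g :: "real \<Rightarrow> real"
  assumes f: "integrable lborel f" and g: "integrable lborel g"
  shows "integrable (lborel \<Otimes>\<^sub>M lborel) (\<lambda>(\<tau>, t). f \<tau> * g (t - \<tau>))"
proof (rule lborel_pair.Fubini_integrable)
  note [measurable] = borel_measurable_integrable[OF f] borel_measurable_integrable[OF g]
  show "(\<lambda>(\<tau>, t). f \<tau> * g (t - \<tau>)) \<in> borel_measurable (lborel \<Otimes>\<^sub>M lborel)"
    by measurable
  have shift: "integrable lborel (\<lambda>t. g (t - \<tau>))" for \<tau>
    using lborel_integrable_real_affine[OF g, of 1 "-\<tau>"] by simp
  have int_shift: "(LINT t|lborel. \<bar>g (t - \<tau>)\<bar>) = (LINT t|lborel. \<bar>g t\<bar>)" for \<tau>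
    using lborel_integral_real_affine[of 1 "\<lambda>t. \<bar>g t\<bar>" "-\<tau>"] by simp
  show "integrable lborel (\<lambda>\<tau>. LINT t|lborel. norm (case (\<tau>, t) of (\<tau>, t) \<Rightarrow> f \<tau> * g (t - \<tau>)))"
    using f by (simp add: abs_mult int_shift)
  show "AE \<tau> in lborel. integrable lborel (\<lambda>t. case (\<tau>, t) of (\<tau>, t) \<Rightarrow> f \<tau> * g (t - \<tau>))"
    using shift by simp
qed

lemma AE_integrable_conv:
  fixes f g :: "real \<Rightarrow> real"
  assumes "integrable lborel f" and "integrable lborel g"
  shows "AE t in lborel. integrable lborel (\<lambda>\<tau>. f \<tau> * g (t - \<tau>))"
  using lborel_pair.AE_integrable_snd[OF integrable_conv_kernel[OF assms]] by simp

lemma integrable_conv: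
  assumes "integrable lborel f" and "integrable lborel g"
  shows "integrable lborel (conv f g)"
  using lborel_pair.integrable_snd[OF integrable_conv_kernel[OF assms]]
  by (simp add: conv_def[abs_def])

lemma integral_conv:
  assumes "integrable lborel f" and "integrable lborel g"
  shows "(LINT t|lborel. conv f g t) = (LINT t|lborel. f t) * (LINT t|lborel. g t)"
proof -
  have "(LINT t|lborel. conv f g t) = (LINT \<tau>|lborel. LINT t|lborel. f \<tau> * g (t - \<tau>))"
    unfolding conv_def
    by (rule lborel_pair.Fubini_integral[OF integrable_conv_kernel[OF assms]])
  also have "\<dots> = (LINT \<tau>|lborel. f \<tau> * (LINT t|lborel. g t))"
    using lborel_integral_real_affine[of 1 g "- \<tau>" for \<tau>] by simp
  finally show ?thesis by simp
qed

lemma abs_conv_le: "\<bar>conv f g t\<bar> \<le> conv (\<lambda>t. \<bar>f t\<bar>) (\<lambda>t. \<bar>g t\<bar>) t"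
  unfolding conv_def abs_mult[symmetric] by (rule integral_abs_bound)

text \<open>
  No exceptional set of \<open>t\<close> arises here, because \<open>\<tau> \<mapsto> t - \<tau>\<close> preserves null sets for each
  fixed \<open>t\<close>.
\<close>
lemma conv_bounded_right:
  assumes f: "integrable lborel f" and d: "integrable lborel d"
    and M: "AE t in lborel. \<bar>d t\<bar> \<le> M" and "0 \<le> M"
  shows "\<bar>conv f d t\<bar> \<le> M * (LINT t|lborel. \<bar>f t\<bar>)"
proof -
  note [measurable] = borel_measurable_integrable[OF d]
  have ae: "AE \<tau> in lborel. \<bar>d (t - \<tau>)\<bar> \<le> M"
    using AE_borel_affine[OF _ _ M, of "-1" t] by simp
  have "conv (\<lambda>t. \<bar>f t\<bar>) (\<lambda>t. \<bar>d t\<bar>) t \<le> (LINT \<tau>|lborel. M * \<bar>f \<tau>\<bar>)"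
    unfolding conv_def
  proof (rule integral_mono_AE')
    show "integrable lborel (\<lambda>\<tau>. M * \<bar>f \<tau>\<bar>)" using f by simp
    show "AE \<tau> in lborel. \<bar>f \<tau>\<bar> * \<bar>d (t - \<tau>)\<bar> \<le> M * \<bar>f \<tau>\<bar>"
      using ae by eventually_elim (simp add: mult.commute[of M] mult_left_mono)
  qed (use \<open>0 \<le> M\<close> in simp)
  then show ?thesis using abs_conv_le[of f d t] by simp
qed

section \<open>Contraction estimates\<close>

text \<open>
  Integrating the hypothesis bounds the norm of \<open>v\<close> by that of \<open>w\<close> plus \<open>k\<close> times itself;
  the norm of \<open>v\<close> is finite, so the last term can be moved to the left.
\<close>
lemma L1_contraction:
  fixes k :: real
  assumes v: "integrable lborel v" and w: "integrable lborel w" and g: "integrable lborel g"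
    and "k < 1" and gk: "(LINT t|lborel. \<bar>g t\<bar>) \<le> k"
    and le: "AE t in lborel. \<bar>v t\<bar> \<le> \<bar>w t\<bar> + conv (\<lambda>t. \<bar>v t\<bar>) (\<lambda>t. \<bar>g t\<bar>) t"
  shows "(LINT t|lborel. \<bar>v t\<bar>) \<le> (LINT t|lborel. \<bar>w t\<bar>) / (1 - k)"
proof -
  have c: "integrable lborel (conv (\<lambda>t. \<bar>v t\<bar>) (\<lambda>t. \<bar>g t\<bar>))"
    using v g by (intro integrable_conv) auto
  have "(LINT t|lborel. \<bar>v t\<bar>) \<le> (LINT t|lborel. \<bar>w t\<bar> + conv (\<lambda>t. \<bar>v t\<bar>) (\<lambda>t. \<bar>g t\<bar>) t)"
    using v w c le by (intro integral_mono_AE) auto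
  also have "\<dots> = (LINT t|lborel. \<bar>w t\<bar>) + (LINT t|lborel. \<bar>v t\<bar>) * (LINT t|lborel. \<bar>g t\<bar>)"
    using v w g c by (simp add: integral_conv)
  also have "\<dots> \<le> (LINT t|lborel. \<bar>w t\<bar>) + (LINT t|lborel. \<bar>v t\<bar>) * k"
    using gk by (simp add: mult_left_mono)
  finally show ?thesis using \<open>k < 1\<close> by (simp add: field_simps)
qed

text \<open>
  The constant \<open>C = M / (1 - k)\<close> is the fixed point of \<open>x \<mapsto> M + k x\<close>. The function
  \<open>\<bar>v\<bar>\<close> is at most \<open>u + C\<close>, where \<open>u\<close> is the positive part of \<open>\<bar>v\<bar> - C\<close>, and the convolution
  of the constant \<open>C\<close> with \<open>\<bar>g\<bar>\<close> is at most \<open>C k\<close>. So \<open>\<bar>v\<bar> - C\<close>, and with it \<open>u\<close>, is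
  dominated by the convolution of \<open>u\<close> with \<open>\<bar>g\<bar>\<close>, and the \<open>L\<^sup>1\<close> estimate forces \<open>u = 0\<close>.
\<close>
lemma sup_contraction:
  fixes k :: real
  assumes v: "integrable lborel v" and g: "integrable lborel g"
    and "k < 1" and gk: "(LINT t|lborel. \<bar>g t\<bar>) \<le> k" and "0 \<le> M"
    and le: "AE t in lborel. \<bar>v t\<bar> \<le> M + conv (\<lambda>t. \<bar>v t\<bar>) (\<lambda>t. \<bar>g t\<bar>) t"
  shows "AE t in lborel. \<bar>v t\<bar> \<le> M / (1 - k)"
proof -
  define C where "C = M / (1 - k)"
  define u where "u t = max 0 (\<bar>v t\<bar> - C)" for t
  have C: "0 \<le> C" "M + C * k = C"
    using \<open>0 \<le> M\<close> \<open>k < 1\<close> by (auto simp: C_def field_simps)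
  note [measurable] = borel_measurable_integrable[OF v]
  have u: "integrable lborel u"
    by (rule Bochner_Integration.integrable_bound[OF v])
       (use C in \<open>auto simp: u_def[abs_def]\<close>)
  have "AE t in lborel. \<bar>u t\<bar> \<le> \<bar>0\<bar> + conv (\<lambda>t. \<bar>u t\<bar>) (\<lambda>t. \<bar>g t\<bar>) t"
    using le AE_integrable_conv[OF integrable_abs[OF v] integrable_abs[OF g]]
      AE_integrable_conv[OF integrable_abs[OF u] integrable_abs[OF g]]
  proof eventually_elim
    case (elim t)
    have gt: "integrable lborel (\<lambda>\<tau>. \<bar>g (t - \<tau>)\<bar>)"
      using integrable_reflect[OF g, of t] by simp
    have nonneg: "0 \<le> conv (\<lambda>t. \<bar>u t\<bar>) (\<lambda>t. \<bar>g t\<bar>) t"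
      by (simp add: conv_def)
    have "conv (\<lambda>t. \<bar>v t\<bar>) (\<lambda>t. \<bar>g t\<bar>) t
        \<le> (LINT \<tau>|lborel. \<bar>u \<tau>\<bar> * \<bar>g (t - \<tau>)\<bar> + C * \<bar>g (t - \<tau>)\<bar>)"
      unfolding conv_def
    proof (rule integral_mono)
      show "\<bar>v \<tau>\<bar> * \<bar>g (t - \<tau>)\<bar> \<le> \<bar>u \<tau>\<bar> * \<bar>g (t - \<tau>)\<bar> + C * \<bar>g (t - \<tau>)\<bar>" for \<tau>
        unfolding distrib_right[symmetric] by (intro mult_right_mono) (auto simp: u_def)
    qed (use elim gt in auto)
    also have "\<dots> = conv (\<lambda>t. \<bar>u t\<bar>) (\<lambda>t. \<bar>g t\<bar>) t + C * (LINT \<tau>|lborel. \<bar>g \<tau>\<bar>)"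
      using elim gt integral_reflect[of "\<lambda>t. \<bar>g t\<bar>" t] by (simp add: conv_def)
    also have "\<dots> \<le> conv (\<lambda>t. \<bar>u t\<bar>) (\<lambda>t. \<bar>g t\<bar>) t + C * k"
      using gk C by (simp add: mult_left_mono)
    finally have "\<bar>v t\<bar> - C \<le> conv (\<lambda>t. \<bar>u t\<bar>) (\<lambda>t. \<bar>g t\<bar>) t"
      using elim C by linarith
    with nonneg show ?case by (simp add: u_def)
  qed
  from L1_contraction[OF u _ g \<open>k < 1\<close> gk this]
  have "(LINT t|lborel. \<bar>u t\<bar>) \<le> 0" by simp
  moreover have "0 \<le> (LINT t|lborel. \<bar>u t\<bar>)" by simp
  ultimately have "(LINT t|lborel. \<bar>u t\<bar>) = 0" by (rule antisym)
  then have "AE t in lborel. \<bar>u t\<bar> = 0"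
    using u by (subst (asm) integral_nonneg_eq_0_iff_AE) auto
  then show ?thesis
    by eventually_elim (auto simp: u_def C_def max_def split: if_splits)
qed

section \<open>Stability of the renewal equation on the whole line\<close>

text \<open>
  The three convolution integrals \<open>h * g\<close>, \<open>h\<^sub>a * g\<^sub>a\<close> and \<open>h\<^sub>a * g\<close> must converge before they
  can be split and recombined by linearity; this holds for almost every \<open>t\<close> only.
\<close>
lemma renewal_difference:
  assumes int: "integrable lborel g" "integrable lborel g\<^sub>a"
      "integrable lborel h" "integrable lborel h\<^sub>a"
    and h: "AE t in lborel. h t = g t + conv h g t"
    and ha: "AE t in lborel. h\<^sub>a t = g\<^sub>a t + conv h\<^sub>a g\<^sub>a t"
  shows "AE t in lborel. h t - h\<^sub>a t = ((g t - g\<^sub>a t) + conv h\<^sub>a (\<lambda>t. g t - g\<^sub>a t) t)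
    + conv (\<lambda>t. h t - h\<^sub>a t) g t"
  using h ha AE_integrable_conv[OF int(3,1)] AE_integrable_conv[OF int(4,2)]
    AE_integrable_conv[OF int(4,1)]
  by eventually_elim (simp add: conv_def algebra_simps)

lemma renewal_L1_bound:
  assumes g: "integrable lborel g" and h: "integrable lborel h"
    and "k < 1" and gk: "(LINT t|lborel. \<bar>g t\<bar>) \<le> k"
    and eq: "AE t in lborel. h t = g t + conv h g t"
  shows "(LINT t|lborel. \<bar>h t\<bar>) \<le> k / (1 - k)"
proof -
  have "AE t in lborel. \<bar>h t\<bar> \<le> \<bar>g t\<bar> + conv (\<lambda>t. \<bar>h t\<bar>) (\<lambda>t. \<bar>g t\<bar>) t"
    using eq
  proof eventually_elim
    case (elim t)
    then show ?case using abs_conv_le[of h g t] by linarith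
  qed
  from L1_contraction[OF h g g \<open>k < 1\<close> gk this]
  show ?thesis using gk \<open>k < 1\<close> by (smt (verit) divide_right_mono)
qed

lemma renewal_stability_line:
  fixes k :: real
  assumes int: "integrable lborel g" "integrable lborel g\<^sub>a"
      "integrable lborel h" "integrable lborel h\<^sub>a"
    and k: "k < 1" and gk: "(LINT t|lborel. \<bar>g t\<bar>) \<le> k" and gak: "(LINT t|lborel. \<bar>g\<^sub>a t\<bar>) \<le> k"
    and h: "AE t in lborel. h t = g t + conv h g t"
    and ha: "AE t in lborel. h\<^sub>a t = g\<^sub>a t + conv h\<^sub>a g\<^sub>a t"
  shows "(LINT t|lborel. \<bar>h t - h\<^sub>a t\<bar>) \<le> 1 / (1 - k)\<^sup>2 * (LINT t|lborel. \<bar>g t - g\<^sub>a t\<bar>)"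
    and "\<And>M. 0 \<le> M \<Longrightarrow> AE t in lborel. \<bar>g t - g\<^sub>a t\<bar> \<le> M \<Longrightarrow>
      AE t in lborel. \<bar>h t - h\<^sub>a t\<bar> \<le> 1 / (1 - k)\<^sup>2 * M"
proof -
  define d where "d t = g t - g\<^sub>a t" for t
  define e where "e t = h t - h\<^sub>a t" for t
  define w where "w t = d t + conv h\<^sub>a d t" for t
  have d: "integrable lborel d" and e: "integrable lborel e"
    using int by (auto simp: d_def[abs_def] e_def[abs_def])
  have w: "integrable lborel w"
    unfolding w_def[abs_def] using d integrable_conv[OF int(4) d] by simp
  have hak: "(LINT t|lborel. \<bar>h\<^sub>a t\<bar>) \<le> k / (1 - k)"
    using int(2,4) k gak ha by (rule renewal_L1_bound)
  \<comment> \<open>the two factors: \<open>1 + k / (1 - k)\<close> from \<open>w\<close>, and \<open>1 / (1 - k)\<close> from absorbing \<open>e * g\<close>\<close>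
  have sq: "1 / (1 - k)\<^sup>2 * x = (x + x * (k / (1 - k))) / (1 - k)" for x
    using k by (simp add: power2_eq_square field_simps)
  have "AE t in lborel. e t = w t + conv e g t"
    using renewal_difference[OF int h ha] by (simp add: d_def[abs_def] e_def[abs_def] w_def)
  then have le: "AE t in lborel. \<bar>e t\<bar> \<le> \<bar>w t\<bar> + conv (\<lambda>t. \<bar>e t\<bar>) (\<lambda>t. \<bar>g t\<bar>) t"
  proof eventually_elim
    case (elim t)
    then show ?case using abs_conv_le[of e g t] by linarith
  qed
  have "(LINT t|lborel. \<bar>w t\<bar>)
      \<le> (LINT t|lborel. \<bar>d t\<bar> + conv (\<lambda>t. \<bar>h\<^sub>a t\<bar>) (\<lambda>t. \<bar>d t\<bar>) t)"
  proof (rule integral_mono)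
    show "\<bar>w t\<bar> \<le> \<bar>d t\<bar> + conv (\<lambda>t. \<bar>h\<^sub>a t\<bar>) (\<lambda>t. \<bar>d t\<bar>) t" for t
      using abs_conv_le[of h\<^sub>a d t] by (simp add: w_def)
  qed (use w d int(4) in \<open>auto intro!: integrable_conv\<close>)
  also have "\<dots> = (LINT t|lborel. \<bar>d t\<bar>) + (LINT t|lborel. \<bar>h\<^sub>a t\<bar>) * (LINT t|lborel. \<bar>d t\<bar>)"
    using d int(4) by (simp add: integral_conv integrable_conv)
  also have "\<dots> \<le> (LINT t|lborel. \<bar>d t\<bar>) + (LINT t|lborel. \<bar>d t\<bar>) * (k / (1 - k))"
    using mult_left_mono[OF hak, of "LINT t|lborel. \<bar>d t\<bar>"] by (simp add: mult.commute)
  finally have wd: "(LINT t|lborel. \<bar>w t\<bar>) \<le> \<dots>" .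
  show "(LINT t|lborel. \<bar>h t - h\<^sub>a t\<bar>) \<le> 1 / (1 - k)\<^sup>2 * (LINT t|lborel. \<bar>g t - g\<^sub>a t\<bar>)"
    using L1_contraction[OF e w int(1) k gk le] divide_right_mono[OF wd, of "1 - k"] k
    unfolding sq d_def e_def by linarith
  show "AE t in lborel. \<bar>h t - h\<^sub>a t\<bar> \<le> 1 / (1 - k)\<^sup>2 * M"
    if M: "0 \<le> M" "AE t in lborel. \<bar>g t - g\<^sub>a t\<bar> \<le> M" for M
  proof -
    define N where "N = M + M * (k / (1 - k))"
    have dM: "AE t in lborel. \<bar>d t\<bar> \<le> M" using M by (simp add: d_def)
    have "\<bar>conv h\<^sub>a d t\<bar> \<le> M * (k / (1 - k))" for t
      using conv_bounded_right[OF int(4) d dM M(1), of t] mult_left_mono[OF hak M(1)] by linarith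
    then have "AE t in lborel. \<bar>w t\<bar> \<le> N"
      using dM unfolding w_def N_def by (smt (verit) eventually_mono)
    with le have "AE t in lborel. \<bar>e t\<bar> \<le> N + conv (\<lambda>t. \<bar>e t\<bar>) (\<lambda>t. \<bar>g t\<bar>) t"
      by eventually_elim linarith
    moreover have "0 \<le> (LINT t|lborel. \<bar>h\<^sub>a t\<bar>)" by simp
    with hak have "0 \<le> k / (1 - k)" by linarith
    with M(1) have "0 \<le> N"
      unfolding N_def by (intro add_nonneg_nonneg mult_nonneg_nonneg)
    ultimately have "AE t in lborel. \<bar>e t\<bar> \<le> N / (1 - k)"
      using sup_contraction[OF e int(1) k gk] by blast
    then show ?thesis unfolding sq e_def N_def .
  qed
qed

section \<open>Passage from Lebesgue to Borel functions\<close>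

text \<open>
  Vanishing on the negative half-line is made to hold at every point, so that a product
  \<open>f' \<tau> * g' (t - \<tau>)\<close> is zero for every \<open>\<tau>\<close> outside \<open>{0..t}\<close>.
\<close>
lemma causal_borel_representative:
  fixes f :: "real \<Rightarrow> real"
  assumes f: "integrable lebesgue f" and neg: "AE t in lebesgue. t < 0 \<longrightarrow> f t = 0"
  obtains f' where "integrable lborel f'" "AE t in lborel. f t = f' t" "\<And>t. t < 0 \<Longrightarrow> f' t = 0"
proof -
  obtain f0 where f0[measurable]: "f0 \<in> borel_measurable lborel" "AE t in lborel. f t = f0 t"
    using completion_ex_borel_measurable_real[OF borel_measurable_integrable[OF f]] by auto
  define f' where "f' t = indicator {0..} t * f0 t" for t
  have [measurable]: "f' \<in> borel_measurable lborel"
    unfolding f'_def[abs_def] by measurable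
  have eq: "AE t in lborel. f t = f' t"
    using f0(2) neg[unfolded AE_completion_iff]
    by eventually_elim (auto simp: f'_def indicator_def)
  have "integrable lebesgue f'"
    using f by (rule integrable_cong_AE_imp)
      (use eq in \<open>auto simp: AE_completion_iff intro: measurable_completion\<close>)
  then have "integrable lborel f'"
    by (simp add: integrable_completion)
  then show ?thesis
    using eq by (rule that) (simp add: f'_def)
qed

text \<open>
  The predicate need not be measurable; it is compared with the complement of a Borel null set.
\<close>
lemma AE_lborel_reflect:
  fixes P :: "real \<Rightarrow> bool"
  assumes "AE x in lborel. P x"
  shows "AE x in lborel. P (t - x)"
proof -
  obtain N where N: "N \<in> null_sets lborel" "{x. \<not> P x} \<subseteq> N"
    using assms by (auto simp: eventually_ae_filter)
  have [measurable]: "N \<in> sets borel" using N by auto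
  have "AE x in lborel. t + (-1) * x \<notin> N"
    by (rule AE_borel_affine) (use N AE_not_in in auto)
  then show ?thesis
    by eventually_elim (use N in auto)
qed

text \<open>
  The equality holds for every \<open>t\<close>, including those where the integrand is not integrable: the
  two integrands agree almost everywhere, so both integrals then take the default value \<open>0\<close>.
\<close>
lemma set_lebesgue_integral_conv:
  fixes f g f' g' :: "real \<Rightarrow> real"
  assumes [measurable]: "f \<in> borel_measurable lebesgue" "g \<in> borel_measurable lebesgue"
    "f' \<in> borel_measurable borel" "g' \<in> borel_measurable borel"
    and f: "AE t in lborel. f t = f' t" "\<And>t. t < 0 \<Longrightarrow> f' t = 0"
    and g: "AE t in lborel. g t = g' t" "\<And>t. t < 0 \<Longrightarrow> g' t = 0"
  shows "(LINT \<tau>:{0..t}|lebesgue. f \<tau> * g (t - \<tau>)) = conv f' g' t"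
proof -
  have [measurable]: "(\<lambda>\<tau>. t - \<tau>) \<in> lebesgue \<rightarrow>\<^sub>M lebesgue"
    using lebesgue_affine_measurable[of "\<lambda>_. -1" t] by simp
  have "(LINT \<tau>:{0..t}|lebesgue. f \<tau> * g (t - \<tau>)) = (LINT \<tau>|lebesgue. f' \<tau> * g' (t - \<tau>))"
    unfolding set_lebesgue_integral_def
  proof (rule integral_cong_AE)
    show "(\<lambda>\<tau>. indicat_real {0..t} \<tau> *\<^sub>R (f \<tau> * g (t - \<tau>))) \<in> borel_measurable lebesgue"
      by (intro borel_measurable_scaleR borel_measurable_indicator borel_measurable_times) simp_all
    show "(\<lambda>\<tau>. f' \<tau> * g' (t - \<tau>)) \<in> borel_measurable lebesgue"
      by (intro measurable_completion) measurable
    show "AE \<tau> in lebesgue. indicat_real {0..t} \<tau> *\<^sub>R (f \<tau> * g (t - \<tau>)) = f' \<tau> * g' (t - \<tau>)"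
      unfolding AE_completion_iff
      using f(1) AE_lborel_reflect[OF g(1), of t]
    proof eventually_elim
      case (elim \<tau>)
      then show ?case
        using f(2)[of \<tau>] g(2)[of "t - \<tau>"] by (cases "\<tau> < 0"; cases "t < \<tau>") auto
    qed
  qed
  then show ?thesis
    by (simp add: conv_def integral_completion)
qed

lemma L1_norm_representative:
  fixes u u' :: "real \<Rightarrow> real"
  assumes [measurable]: "u \<in> borel_measurable lebesgue" "u' \<in> borel_measurable borel"
    and u: "AE t in lborel. u t = u' t" "\<And>t. t < 0 \<Longrightarrow> u' t = 0"
  shows "L1_norm u = (LINT t|lborel. \<bar>u' t\<bar>)"
proof -
  have "L1_norm u = (LINT t|lebesgue. \<bar>u' t\<bar>)"
    unfolding L1_norm_def set_lebesgue_integral_def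
  proof (rule integral_cong_AE)
    show "(\<lambda>t. \<bar>u' t\<bar>) \<in> borel_measurable lebesgue"
      by (intro measurable_completion) measurable
    show "AE t in lebesgue. indicat_real {0..} t *\<^sub>R \<bar>u t\<bar> = \<bar>u' t\<bar>"
      unfolding AE_completion_iff
      using u(1) by eventually_elim (auto simp: indicator_def u(2) not_le)
  qed (intro borel_measurable_scaleR borel_measurable_indicator borel_measurable_abs; simp)
  then show ?thesis by (simp add: integral_completion)
qed

text \<open>
  The equation is imposed for \<open>t \<ge> 0\<close> only, but the representatives satisfy it on the whole
  line, as all three terms vanish at negative \<open>t\<close>.
\<close>
lemma solves_renewal_representative:
  assumes sol: "solves_renewal g h" and g: "integrable lebesgue g"
    and g': "integrable lborel g'" "AE t in lborel. g t = g' t" "\<And>t. t < 0 \<Longrightarrow> g' t = 0"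
    and h': "integrable lborel h'" "AE t in lborel. h t = h' t" "\<And>t. t < 0 \<Longrightarrow> h' t = 0"
  shows "AE t in lborel. h' t = g' t + conv h' g' t"
proof -
  have h: "integrable lebesgue h"
    and eq: "AE t in lborel. 0 \<le> t \<longrightarrow> h t = g t + (LINT \<tau>:{0..t}|lebesgue. h \<tau> * g (t - \<tau>))"
    using sol by (auto simp: solves_renewal_def AE_completion_iff)
  have conv: "(LINT \<tau>:{0..t}|lebesgue. h \<tau> * g (t - \<tau>)) = conv h' g' t" for t
    using borel_measurable_integrable[OF g] borel_measurable_integrable[OF h]
      borel_measurable_integrable[OF g'(1)] borel_measurable_integrable[OF h'(1)]
    by (intro set_lebesgue_integral_conv g' h') auto
  have neg: "conv h' g' t = 0" if "t < 0" for t
  proof -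
    have "h' \<tau> * g' (t - \<tau>) = 0" for \<tau>
      using that g'(3)[of "t - \<tau>"] h'(3)[of \<tau>] by (cases "\<tau> < 0") auto
    then show ?thesis by (simp only: conv_def integral_zero)
  qed
  show ?thesis
    using eq g'(2) h'(2)
  proof eventually_elim
    case (elim t)
    then show ?case
      using neg[of t] g'(3)[of t] h'(3)[of t] conv[of t] by (cases "t < 0") auto
  qed
qed

lemma Linf_norm_leI:
  assumes "u \<in> borel_measurable lebesgue" and "AE t in lborel. 0 \<le> t \<longrightarrow> \<bar>u t\<bar> \<le> c"
  shows "Linf_norm u \<le> ereal c"
  unfolding Linf_norm_def
proof (rule esssup_I)
  have [measurable]: "u \<in> borel_measurable (lebesgue_on {0..})"
    using assms(1) by (rule measurable_restrict_space1)
  show "(\<lambda>t. ereal \<bar>u t\<bar>) \<in> borel_measurable (lebesgue_on {0..})" by measurable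
  show "AE t in lebesgue_on {0..}. ereal \<bar>u t\<bar> \<le> ereal c"
    using assms(2) by (simp add: AE_restrict_space_iff AE_completion_iff)
qed

lemma AE_le_Linf_norm: "AE t in lborel. 0 \<le> t \<longrightarrow> ereal \<bar>u t\<bar> \<le> Linf_norm u"
  using esssup_AE[of "\<lambda>t. ereal \<bar>u t\<bar>" "lebesgue_on {0..}"]
  by (simp add: AE_restrict_space_iff AE_completion_iff Linf_norm_def)

text \<open>
  The essential supremum over a null set is \<open>-\<infinity>\<close>, so this uses that the half-line has positive
  measure.
\<close>
lemma Linf_norm_nonneg: "0 \<le> Linf_norm u"
proof (rule ccontr)
  assume neg: "\<not> 0 \<le> Linf_norm u"
  have "AE t in lborel. \<not> (0::real) \<le> t"
    using AE_le_Linf_norm[of u]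
  proof eventually_elim
    case (elim t)
    have "0 \<le> ereal \<bar>u t\<bar>" by simp
    then show ?case using elim neg order_trans by blast
  qed
  then have "emeasure lborel {0::real..} = 0"
    by (subst (asm) AE_iff_measurable[OF _ refl]) (auto simp: atLeast_def)
  moreover have "emeasure lborel {0..1::real} \<le> emeasure lborel {0::real..}"
    by (intro emeasure_mono) auto
  ultimately show False by simp
qed

theorem mainTheorem2:
  fixes k :: real and g g\<^sub>a h h\<^sub>a :: "real \<Rightarrow> real"
  assumes "0 < k" and "k < 1"
    and "g \<in> L1_plus" and "g\<^sub>a \<in> L1_plus"
    and "L1_norm g \<le> k" and "L1_norm g\<^sub>a \<le> k"
    and "solves_renewal g h" and "solves_renewal g\<^sub>a h\<^sub>a"
  shows "L1_norm (\<lambda>t. h t - h\<^sub>a t) \<le> 1 / (1 - k)\<^sup>2 * L1_norm (\<lambda>t. g t - g\<^sub>a t)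
    \<and> Linf_norm (\<lambda>t. h t - h\<^sub>a t) \<le> ereal (1 / (1 - k)\<^sup>2) * Linf_norm (\<lambda>t. g t - g\<^sub>a t)"
proof -
  have g: "integrable lebesgue g" "AE t in lebesgue. t < 0 \<longrightarrow> g t = 0"
    and ga: "integrable lebesgue g\<^sub>a" "AE t in lebesgue. t < 0 \<longrightarrow> g\<^sub>a t = 0"
    using assms(3,4) by (auto simp: L1_plus_def)
  have h: "integrable lebesgue h" "AE t in lebesgue. t < 0 \<longrightarrow> h t = 0"
    and ha: "integrable lebesgue h\<^sub>a" "AE t in lebesgue. t < 0 \<longrightarrow> h\<^sub>a t = 0"
    using assms(7,8) by (auto simp: solves_renewal_def)
  note meas[measurable] = g(1)[THEN borel_measurable_integrable] ga(1)[THEN borel_measurable_integrable]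
    h(1)[THEN borel_measurable_integrable] ha(1)[THEN borel_measurable_integrable]
  obtain G where G: "integrable lborel G" "AE t in lborel. g t = G t" "\<And>t. t < 0 \<Longrightarrow> G t = 0"
    using causal_borel_representative[OF g] by blast
  obtain G\<^sub>a where Ga: "integrable lborel G\<^sub>a" "AE t in lborel. g\<^sub>a t = G\<^sub>a t" "\<And>t. t < 0 \<Longrightarrow> G\<^sub>a t = 0"
    using causal_borel_representative[OF ga] by blast
  obtain H where H: "integrable lborel H" "AE t in lborel. h t = H t" "\<And>t. t < 0 \<Longrightarrow> H t = 0"
    using causal_borel_representative[OF h] by blast
  obtain H\<^sub>a where Ha: "integrable lborel H\<^sub>a" "AE t in lborel. h\<^sub>a t = H\<^sub>a t" "\<And>t. t < 0 \<Longrightarrow> H\<^sub>a t = 0"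
    using causal_borel_representative[OF ha] by blast
  have [measurable]: "G \<in> borel_measurable borel" "G\<^sub>a \<in> borel_measurable borel"
    "H \<in> borel_measurable borel" "H\<^sub>a \<in> borel_measurable borel"
    using G(1) Ga(1) H(1) Ha(1) by (auto dest: borel_measurable_integrable)
  have d: "AE t in lborel. g t - g\<^sub>a t = G t - G\<^sub>a t"
    using G(2) Ga(2) by eventually_elim simp
  have e: "AE t in lborel. h t - h\<^sub>a t = H t - H\<^sub>a t"
    using H(2) Ha(2) by eventually_elim simp
  have norms: "L1_norm g = (LINT t|lborel. \<bar>G t\<bar>)" "L1_norm g\<^sub>a = (LINT t|lborel. \<bar>G\<^sub>a t\<bar>)"
    "L1_norm (\<lambda>t. g t - g\<^sub>a t) = (LINT t|lborel. \<bar>G t - G\<^sub>a t\<bar>)"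
    "L1_norm (\<lambda>t. h t - h\<^sub>a t) = (LINT t|lborel. \<bar>H t - H\<^sub>a t\<bar>)"
    by (intro L1_norm_representative; use G(2,3) Ga(2,3) H(3) Ha(3) d e in simp)+
  have eq: "AE t in lborel. H t = G t + conv H G t"
    using assms(7) g(1) G H by (rule solves_renewal_representative)
  have eqa: "AE t in lborel. H\<^sub>a t = G\<^sub>a t + conv H\<^sub>a G\<^sub>a t"
    using assms(8) ga(1) Ga Ha by (rule solves_renewal_representative)
  note stability = renewal_stability_line[OF G(1) Ga(1) H(1) Ha(1) \<open>k < 1\<close>
      assms(5)[unfolded norms] assms(6)[unfolded norms] eq eqa]
  have "Linf_norm (\<lambda>t. h t - h\<^sub>a t) \<le> ereal (1 / (1 - k)\<^sup>2) * Linf_norm (\<lambda>t. g t - g\<^sub>a t)"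
  proof (cases "Linf_norm (\<lambda>t. g t - g\<^sub>a t)")
    case (real M)
    have "0 \<le> M" using Linf_norm_nonneg[of "\<lambda>t. g t - g\<^sub>a t"] real by simp
    have "AE t in lborel. \<bar>G t - G\<^sub>a t\<bar> \<le> M"
      using AE_le_Linf_norm[of "\<lambda>t. g t - g\<^sub>a t"] d
    proof eventually_elim
      case (elim t)
      then show ?case
        using real \<open>0 \<le> M\<close> G(3)[of t] Ga(3)[of t] by (cases "t < 0") auto
    qed
    from stability(2)[OF \<open>0 \<le> M\<close> this] e
    have "AE t in lborel. 0 \<le> t \<longrightarrow> \<bar>h t - h\<^sub>a t\<bar> \<le> 1 / (1 - k)\<^sup>2 * M"
      by eventually_elim simp
    then have "Linf_norm (\<lambda>t. h t - h\<^sub>a t) \<le> ereal (1 / (1 - k)\<^sup>2 * M)"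
      by (intro Linf_norm_leI) measurable
    then show ?thesis by (simp add: real)
  next
    case PInf
    then show ?thesis using \<open>k < 1\<close> by simp
  next
    case MInf
    then show ?thesis using Linf_norm_nonneg[of "\<lambda>t. g t - g\<^sub>a t"] by simp
  qed
  with stability(1) norms show ?thesis by simp
qed

end
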